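(* For $A\in\mathcal{L}_0$ the following are equivalent: (1) $A$ is ${\sf IPC}$-equivalent to an ${\sf IPC}$-component; (2) $A$ is extendible; (3) $A$ is ${\sf IPC}$-prime.
   Context: $\mathcal{L}_0$ is the propositional language with $\wedge,\vee,\to,\bot$ over a finite set of atoms; $\vdash$ is ${\sf IPC}$-derivability. ${\sf NNIL}$ is the least class containing atoms, $\bot,\top$, closed under $\wedge,\vee$, and containing $B\to C$ whenever $C\in{\sf NNIL}$ and $B$ is built from atoms, $\bot,\top$ by $\wedge,\vee$ only. An ${\sf IPC}$-component is a formula $A\in{\sf NNIL}$ of the form $\bigwedge\Gamma\wedge\bigwedge\Delta$ with $\Gamma$ a finite set of atoms and $\Delta$ a finite set of implications $C\to D$ with $C$ an atom such that $\nvdash\bigwedge\Gamma\to C$. $A$ is ${\sf IPC}$-prime if $\vdash A\to(B\vee C)$ implies $\vdash A\to B$ or $\vdash A\to C$. Kripke models are finite, rooted, with tree frame $(W,\prec)$ and persistent valuation, with the usual intuitionistic forcing; $\mathcal{K}\Vdash A$ means the root forces $A$, $\mathcal{K}\Vdash^-A$ means every non-root node forces $A$. $\mathcal{K}'=(W',\prec',V')$ is a subframe-model of $\mathcal{K}=(W,\prec,V)$ if $W'\subseteq W$ and $\prec'$ is the restriction of $\prec$ (valuations arbitrary). A variant of $\mathcal{K}'$ is a model with the same frame and the same valuation except possibly at the root. $A$ is extendible if for every Kripke model $\mathcal{K}\Vdash A$ and every Kripke model $\mathcal{K}'$ which is a subframe-model of $\mathcal{K}$ with $\mathcal{K}'\Vdash^-A$,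 some variant $\mathcal{K}''$ of $\mathcal{K}'$ satisfies $\mathcal{K}''\Vdash A$.
   Formalization: (3)⇒(1) is stated only for A equivalent to a NNIL formula, since ¬¬p is prime and extendible but not equivalent to a component; (1)⇒(2)⇒(3) hold for all A. ⊥ counts as an atom in components, since ⊥ is vacuously extendible and prime. *)

theory Defs
  imports Main
begin

section \<open>Intuitionistic propositional logic\<close>

text \<open>The finite set of atoms of the language is the universe of a type \<open>'a :: finite\<close>.\<close>

datatype 'a fm =
    Atom 'a
  | Bot  (\<open>\<^bold>\<bottom>\<close>)
  | And "'a fm" "'a fm"  (infixr \<open>\<^bold>\<and>\<close> 65)
  | Or "'a fm" "'a fm"  (infixr \<open>\<^bold>\<or>\<close> 60)
  | Imp "'a fm" "'a fm"  (infixr \<open>\<^bold>\<rightarrow>\<close> 55)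

abbreviation Top :: "'a fm"  (\<open>\<^bold>\<top>\<close>) where
  "\<^bold>\<top> \<equiv> \<^bold>\<bottom> \<^bold>\<rightarrow> \<^bold>\<bottom>"

inductive ipc :: "'a fm \<Rightarrow> bool"  (\<open>\<turnstile> _\<close> [50] 50) where
  K:     "\<turnstile> A \<^bold>\<rightarrow> B \<^bold>\<rightarrow> A"
| S:     "\<turnstile> (A \<^bold>\<rightarrow> B \<^bold>\<rightarrow> C) \<^bold>\<rightarrow> (A \<^bold>\<rightarrow> B) \<^bold>\<rightarrow> A \<^bold>\<rightarrow> C"
| AndI:  "\<turnstile> A \<^bold>\<rightarrow> B \<^bold>\<rightarrow> A \<^bold>\<and> B"
| AndE1: "\<turnstile> A \<^bold>\<and> B \<^bold>\<rightarrow> A"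
| AndE2: "\<turnstile> A \<^bold>\<and> B \<^bold>\<rightarrow> B"
| OrI1:  "\<turnstile> A \<^bold>\<rightarrow> A \<^bold>\<or> B"
| OrI2:  "\<turnstile> B \<^bold>\<rightarrow> A \<^bold>\<or> B"
| OrE:   "\<turnstile> (A \<^bold>\<rightarrow> C) \<^bold>\<rightarrow> (B \<^bold>\<rightarrow> C) \<^bold>\<rightarrow> A \<^bold>\<or> B \<^bold>\<rightarrow> C"
| BotE:  "\<turnstile> \<^bold>\<bottom> \<^bold>\<rightarrow> A"
| MP:    "\<turnstile> A \<^bold>\<rightarrow> B \<Longrightarrow> \<turnstile> A \<Longrightarrow> \<turnstile> B"

definition ipc_equiv :: "'a fm \<Rightarrow> 'a fm \<Rightarrow> bool" where
  "ipc_equiv A B \<longleftrightarrow> (\<turnstile> A \<^bold>\<rightarrow> B) \<and> (\<turnstile> B \<^bold>\<rightarrow> A)"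

definition ipc_prime :: "'a fm \<Rightarrow> bool" where
  "ipc_prime A \<longleftrightarrow> (\<forall>B C. (\<turnstile> A \<^bold>\<rightarrow> B \<^bold>\<or> C) \<longrightarrow> (\<turnstile> A \<^bold>\<rightarrow> B) \<or> (\<turnstile> A \<^bold>\<rightarrow> C))"


section \<open>NNIL formulas and components\<close>

inductive_set positive :: "'a fm set" where
  "Atom p \<in> positive"
| "\<^bold>\<bottom> \<in> positive"
| "\<^bold>\<top> \<in> positive"
| "A \<in> positive \<Longrightarrow> B \<in> positive \<Longrightarrow> A \<^bold>\<and> B \<in> positive"
| "A \<in> positive \<Longrightarrow> B \<in> positive \<Longrightarrow> A \<^bold>\<or> B \<in> positive"

inductive_set NNIL :: "'a fm set" where
  "Atom p \<in> NNIL"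
| "\<^bold>\<bottom> \<in> NNIL"
| "\<^bold>\<top> \<in> NNIL"
| "A \<in> NNIL \<Longrightarrow> B \<in> NNIL \<Longrightarrow> A \<^bold>\<and> B \<in> NNIL"
| "A \<in> NNIL \<Longrightarrow> B \<in> NNIL \<Longrightarrow> A \<^bold>\<or> B \<in> NNIL"
| "B \<in> positive \<Longrightarrow> C \<in> NNIL \<Longrightarrow> B \<^bold>\<rightarrow> C \<in> NNIL"

text \<open>
  In the definition of components \<open>\<^bold>\<bottom>\<close> counts as an atom. Otherwise \<open>\<^bold>\<bottom>\<close>, which is
  vacuously extendible and prime, would not be equivalent to a component. Even so, extendible
  or prime formulas need not be equivalent to components in general: the double negation of an
  atom is both, but it is not equivalent to any formula in \<open>NNIL\<close>.
\<close>

fun atomic :: "'a fm \<Rightarrow> bool" where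
  "atomic (Atom p) = True"
| "atomic \<^bold>\<bottom> = True"
| "atomic _ = False"

text \<open>The finite sets of conjuncts are represented by lists.\<close>

definition Conj :: "'a fm list \<Rightarrow> 'a fm" where
  "Conj As = foldr And As \<^bold>\<top>"

definition ipc_component :: "'a fm \<Rightarrow> bool" where
  "ipc_component A \<longleftrightarrow> A \<in> NNIL \<and>
     (\<exists>\<Gamma> \<Delta>. A = Conj \<Gamma> \<^bold>\<and> Conj \<Delta> \<and>
        (\<forall>C \<in> set \<Gamma>. atomic C) \<and>
        (\<forall>E \<in> set \<Delta>. \<exists>C D. E = C \<^bold>\<rightarrow> D \<and> atomic C \<and> \<not> (\<turnstile> Conj \<Gamma> \<^bold>\<rightarrow> C)))"


section \<open>Kripke models and extendibility\<close>

text \<open>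
  Worlds are natural numbers; every finite model has an isomorphic copy of this kind.
  The relation \<open>prec\<close> is the strict order of the tree.
\<close>

record 'a kripke =
  worlds :: "nat set"
  prec :: "(nat \<times> nat) set"
  val :: "nat \<Rightarrow> 'a set"

definition is_root :: "'a kripke \<Rightarrow> nat \<Rightarrow> bool" where
  "is_root K r \<longleftrightarrow> r \<in> worlds K \<and> (\<forall>w \<in> worlds K. w \<noteq> r \<longrightarrow> (r, w) \<in> prec K)"

definition kripke_model :: "'a kripke \<Rightarrow> bool" where
  "kripke_model K \<longleftrightarrow>
     finite (worlds K) \<and>
     prec K \<subseteq> worlds K \<times> worlds K \<and> irrefl (prec K) \<and> trans (prec K) \<and>
     (\<exists>r. is_root K r) \<and>
     (\<forall>u v w. (u, w) \<in> prec K \<and> (v, w) \<in> prec K \<longrightarrow>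
        u = v \<or> (u, v) \<in> prec K \<or> (v, u) \<in> prec K) \<and>
     (\<forall>u v. (u, v) \<in> prec K \<longrightarrow> val K u \<subseteq> val K v)"

definition root :: "'a kripke \<Rightarrow> nat" where
  "root K = (THE r. is_root K r)"

primrec forces :: "'a kripke \<Rightarrow> nat \<Rightarrow> 'a fm \<Rightarrow> bool" where
  "forces K w (Atom p) \<longleftrightarrow> p \<in> val K w"
| "forces K w \<^bold>\<bottom> \<longleftrightarrow> False"
| "forces K w (A \<^bold>\<and> B) \<longleftrightarrow> forces K w A \<and> forces K w B"
| "forces K w (A \<^bold>\<or> B) \<longleftrightarrow> forces K w A \<or> forces K w B"
| "forces K w (A \<^bold>\<rightarrow> B) \<longleftrightarrow>
     (\<forall>v \<in> worlds K. v = w \<or> (w, v) \<in> prec K \<longrightarrow> forces K v A \<longrightarrow> forces K v B)"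

definition model_forces :: "'a kripke \<Rightarrow> 'a fm \<Rightarrow> bool" where
  "model_forces K A \<longleftrightarrow> forces K (root K) A"

definition model_forces_minus :: "'a kripke \<Rightarrow> 'a fm \<Rightarrow> bool" where
  "model_forces_minus K A \<longleftrightarrow> (\<forall>w \<in> worlds K - {root K}. forces K w A)"

text \<open>No condition relates the two valuations.\<close>

definition subframe_model :: "'a kripke \<Rightarrow> 'a kripke \<Rightarrow> bool" where
  "subframe_model K' K \<longleftrightarrow>
     worlds K' \<subseteq> worlds K \<and> prec K' = prec K \<inter> (worlds K' \<times> worlds K')"

definition variant :: "'a kripke \<Rightarrow> 'a kripke \<Rightarrow> bool" where
  "variant K'' K' \<longleftrightarrow> kripke_model K'' \<and>
     worlds K'' = worlds K' \<and> prec K'' = prec K' \<and>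
     (\<forall>w \<in> worlds K' - {root K'}. val K'' w = val K' w)"

definition extendible :: "'a fm \<Rightarrow> bool" where
  "extendible A \<longleftrightarrow>
     (\<forall>K K'. kripke_model K \<and> model_forces K A \<and>
        kripke_model K' \<and> subframe_model K' K \<and> model_forces_minus K' A \<longrightarrow>
        (\<exists>K''. variant K'' K' \<and> model_forces K'' A))"

end

theory Submission
  imports Defs "HOL-Library.Nat_Bijection"
begin

text \<open>
  For a component, giving the root exactly the atoms of \<open>\<Gamma>\<close> makes the root force \<open>A\<close>, since no
  implication of \<open>\<Delta>\<close> is triggered there. If \<open>A\<close> is extendible and derives neither \<open>B\<close> nor \<open>C\<close>,
  then two countermodels are put above a new root, and a variant of the result forces \<open>A\<close> but not
  \<open>B \<^bold>\<or> C\<close>. Finally, a prime formula equivalent to one in \<open>NNIL\<close> is kept in the form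
  \<open>Conj \<Gamma> \<^bold>\<and> Conj \<Theta>\<close>: atoms of \<open>\<Theta>\<close> move to \<open>\<Gamma>\<close>, compound antecedents are split, implications
  whose antecedent follows from \<open>\<Gamma>\<close> are replaced by their conclusion, and primeness selects a
  disjunct of every disjunction, until only the implications allowed in a component are left.
\<close>

section \<open>Kripke semantics\<close>

lemma kripke_model_trans:
  "kripke_model K \<Longrightarrow> (u, v) \<in> prec K \<Longrightarrow> (v, w) \<in> prec K \<Longrightarrow> (u, w) \<in> prec K"
  unfolding kripke_model_def by (meson transD)

lemma kripke_model_irrefl: "kripke_model K \<Longrightarrow> (u, u) \<notin> prec K"
  unfolding kripke_model_def by (meson irreflD)

lemma kripke_model_worlds:
  assumes "kripke_model K" "(u, v) \<in> prec K"
  shows "u \<in> worlds K" "v \<in> worlds K"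
  using assms unfolding kripke_model_def by auto

lemma kripke_model_val: "kripke_model K \<Longrightarrow> (u, v) \<in> prec K \<Longrightarrow> val K u \<subseteq> val K v"
  unfolding kripke_model_def by blast

lemma is_root_unique:
  assumes "kripke_model K" "is_root K r" "is_root K s"
  shows "r = s"
  using assms kripke_model_trans kripke_model_irrefl unfolding is_root_def by metis

lemma root_eqI: "kripke_model K \<Longrightarrow> is_root K r \<Longrightarrow> root K = r"
  unfolding root_def using is_root_unique by blast

lemma is_root_root: "kripke_model K \<Longrightarrow> is_root K (root K)"
  using root_eqI unfolding kripke_model_def by metis

lemma root_in_worlds: "kripke_model K \<Longrightarrow> root K \<in> worlds K"
  using is_root_root unfolding is_root_def by blast

lemma root_prec: "kripke_model K \<Longrightarrow> w \<in> worlds K \<Longrightarrow> w \<noteq> root K \<Longrightarrow> (root K, w) \<in> prec K"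
  using is_root_root unfolding is_root_def by blast

lemma is_root_cong: "worlds K = worlds K' \<Longrightarrow> prec K = prec K' \<Longrightarrow> is_root K = is_root K'"
  unfolding is_root_def by auto

lemma root_cong: "worlds K = worlds K' \<Longrightarrow> prec K = prec K' \<Longrightarrow> root K = root K'"
  unfolding root_def using is_root_cong by metis

lemma forces_mono:
  assumes "kripke_model K" "(u, v) \<in> prec K" "forces K u A"
  shows "forces K v A"
  using assms(2,3)
proof (induction A)
  case (Atom p)
  then show ?case using kripke_model_val[OF assms(1)] by auto
next
  case (Imp A B)
  then show ?case using kripke_model_trans[OF assms(1)] by auto
qed auto

lemma forces_root_mono:
  "kripke_model K \<Longrightarrow> w \<in> worlds K \<Longrightarrow> forces K (root K) A \<Longrightarrow> forces K w A"
  using forces_mono root_prec by metis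

text \<open>Persistence is handed over as a premise about all formulas \<open>F\<close>, so that
  verifying an axiom at \<open>v\<close> is plain propositional reasoning without mention of
  \<open>prec\<close>.\<close>

lemma forces_ImpI:
  assumes "kripke_model K"
    and "\<And>v. v \<in> worlds K \<Longrightarrow> (\<And>F. forces K w F \<Longrightarrow> forces K v F) \<Longrightarrow> forces K v A \<Longrightarrow> forces K v B"
  shows "forces K w (A \<^bold>\<rightarrow> B)"
  using assms forces_mono[OF assms(1)] by auto

lemma forces_ImpD: "w \<in> worlds K \<Longrightarrow> forces K w (A \<^bold>\<rightarrow> B) \<Longrightarrow> forces K w A \<Longrightarrow> forces K w B"
  by simp

lemma soundness:
  assumes "\<turnstile> A" "kripke_model K" "w \<in> worlds K"
  shows "forces K w A"
  using assms(1,3)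
proof (induction arbitrary: w)
  case (K A B)
  show ?case by (intro forces_ImpI[OF assms(2)]) metis
next
  case (S A B C)
  show ?case by (intro forces_ImpI[OF assms(2)]) (metis forces_ImpD)
next
  case (AndI A B)
  show ?case by (intro forces_ImpI[OF assms(2)]) (metis forces.simps(3))
next
  case (OrE A C B)
  show ?case
    by (intro forces_ImpI[OF assms(2)]) (metis forces.simps(4) forces_ImpD)
next
  case (MP A B)
  then show ?case by (metis forces_ImpD)
qed auto

lemma forces_Conj [simp]: "forces K w (Conj As) \<longleftrightarrow> (\<forall>B \<in> set As. forces K w B)"
  by (induction As) (auto simp: Conj_def)

section \<open>Gluing models above a new root\<close>

text \<open>The worlds of the member \<open>Ks ! i\<close> are renamed apart; \<open>0\<close> becomes the new root.\<close>

definition node :: "nat \<Rightarrow> nat \<Rightarrow> nat" where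
  "node i w = Suc (prod_encode (i, w))"

text \<open>The empty list is allowed: it gives the one-world model with valuation \<open>v\<close>,
  the leaf case of the completeness construction.\<close>

definition glue :: "'a set \<Rightarrow> 'a kripke list \<Rightarrow> 'a kripke" where
  "glue v Ks =
     (let W = {node i w | i w. i < length Ks \<and> w \<in> worlds (Ks ! i)} in
     \<lparr>worlds = insert 0 W,
      prec = {0} \<times> W \<union> {(node i u, node i w) | i u w. i < length Ks \<and> (u, w) \<in> prec (Ks ! i)},
      val = (\<lambda>x. case x of 0 \<Rightarrow> v
                 | Suc y \<Rightarrow> case prod_decode y of (i, w) \<Rightarrow> val (Ks ! i) w)\<rparr>)"

lemma node_simps [simp]:
  "node i w = node j u \<longleftrightarrow> i = j \<and> w = u" "node i w \<noteq> 0" "0 \<noteq> node i w"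
  by (auto simp: node_def)

lemma worlds_glue:
  "x \<in> worlds (glue v Ks) \<longleftrightarrow>
     x = 0 \<or> (\<exists>i w. x = node i w \<and> i < length Ks \<and> w \<in> worlds (Ks ! i))"
  by (auto simp: glue_def Let_def)

lemma prec_glue:
  "(x, y) \<in> prec (glue v Ks) \<longleftrightarrow>
     (x = 0 \<and> (\<exists>i w. y = node i w \<and> i < length Ks \<and> w \<in> worlds (Ks ! i))) \<or>
     (\<exists>i u w. x = node i u \<and> y = node i w \<and> i < length Ks \<and> (u, w) \<in> prec (Ks ! i))"
  by (auto simp: glue_def Let_def)

lemma val_glue [simp]:
  "val (glue v Ks) 0 = v" "val (glue v Ks) (node i w) = val (Ks ! i) w"
  by (simp_all add: glue_def node_def Let_def)

lemma is_root_glue: "is_root (glue v Ks) 0"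
  by (auto simp: is_root_def worlds_glue prec_glue)

text \<open>Comparing \<open>v\<close> with the roots of the members suffices, since persistence
  inside each member carries \<open>v\<close> further up. The order stays a tree because below a
  world of a copy there are only \<open>0\<close> and worlds of the same copy.\<close>

lemma kripke_model_glue:
  assumes models: "\<And>K. K \<in> set Ks \<Longrightarrow> kripke_model K \<and> v \<subseteq> val K (root K)"
  shows "kripke_model (glue v Ks)"
proof -
  let ?G = "glue v Ks"
  have M: "kripke_model (Ks ! i)" and V: "v \<subseteq> val (Ks ! i) (root (Ks ! i))"
    if "i < length Ks" for i
    using models[of "Ks ! i"] that by auto
  have "worlds ?G = insert 0 (\<Union>i<length Ks. node i ` worlds (Ks ! i))"
    by (fastforce simp: worlds_glue)
  moreover have "finite (worlds (Ks ! i))" if "i < length Ks" for i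
    using M[OF that] unfolding kripke_model_def by blast
  ultimately have fin: "finite (worlds ?G)"
    by auto
  have sub: "prec ?G \<subseteq> worlds ?G \<times> worlds ?G"
    using kripke_model_worlds[OF M] by (auto simp: worlds_glue prec_glue)
  have irr: "irrefl (prec ?G)"
    using kripke_model_irrefl[OF M] by (auto simp: irrefl_def prec_glue)
  have tr: "trans (prec ?G)"
  proof (rule transI)
    fix x y z assume xy: "(x, y) \<in> prec ?G" and yz: "(y, z) \<in> prec ?G"
    then obtain i u w where i: "i < length Ks" and uw: "(u, w) \<in> prec (Ks ! i)"
      and yz': "y = node i u" "z = node i w"
      by (auto simp: prec_glue)
    from xy yz' consider "x = 0" | t where "x = node i t" "(t, u) \<in> prec (Ks ! i)"
      by (auto simp: prec_glue)
    then show "(x, z) \<in> prec ?G"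
    proof cases
      case 1
      then show ?thesis using i yz' kripke_model_worlds(2)[OF M[OF i] uw] by (auto simp: prec_glue)
    next
      case 2
      then show ?thesis
        using i yz' kripke_model_trans[OF M[OF i] 2(2) uw] by (auto simp: prec_glue)
    qed
  qed
  have tree: "x = y \<or> (x, y) \<in> prec ?G \<or> (y, x) \<in> prec ?G"
    if xy: "(x, z) \<in> prec ?G" "(y, z) \<in> prec ?G" for x y z
  proof (cases "x = 0 \<or> y = 0")
    case True
    then show ?thesis
      using xy sub is_root_glue[of v Ks] unfolding is_root_def by auto
  next
    case False
    then obtain i u w t where i: "i < length Ks" and uw: "x = node i u" "y = node i w"
      and t: "(u, t) \<in> prec (Ks ! i)" "(w, t) \<in> prec (Ks ! i)"
      using xy by (auto simp: prec_glue)
    have "u = w \<or> (u, w) \<in> prec (Ks ! i) \<or> (w, u) \<in> prec (Ks ! i)"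
      using M[OF i] t unfolding kripke_model_def by blast
    then show ?thesis using i uw by (auto simp: prec_glue)
  qed
  have mono: "val ?G x \<subseteq> val ?G y" if "(x, y) \<in> prec ?G" for x y
    using that unfolding prec_glue
  proof (elim disjE conjE exE)
    fix i w assume xy: "x = 0" "y = node i w" and i: "i < length Ks" and w: "w \<in> worlds (Ks ! i)"
    have "val (Ks ! i) (root (Ks ! i)) \<subseteq> val (Ks ! i) w"
      using kripke_model_val[OF M[OF i]] root_prec[OF M[OF i] w] by blast
    then show ?thesis using xy V[OF i] by auto
  next
    fix i u w
    assume "x = node i u" "y = node i w" and i: "i < length Ks" and "(u, w) \<in> prec (Ks ! i)"
    then show ?thesis using kripke_model_val[OF M[OF i]] by auto
  qed
  show ?thesis
    unfolding kripke_model_def using fin sub irr tr tree mono is_root_glue[of v Ks] by blast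
qed

lemma node_glue:
  assumes "i < length Ks"
  shows "node i w \<in> worlds (glue v Ks) \<longleftrightarrow> w \<in> worlds (Ks ! i)"
    and "(node i w, x) \<in> prec (glue v Ks) \<longleftrightarrow> (\<exists>u. x = node i u \<and> (w, u) \<in> prec (Ks ! i))"
  using assms by (auto simp: worlds_glue prec_glue)

text \<open>Forcing only looks upward, and by \<open>node_glue\<close> everything above
  \<open>node i w\<close> lies in the same copy.\<close>

lemma forces_glue:
  "i < length Ks \<Longrightarrow> forces (glue v Ks) (node i w) A \<longleftrightarrow> forces (Ks ! i) w A"
  by (induction A arbitrary: w) (auto simp: node_glue)


section \<open>Completeness for finite tree models\<close>

text \<open>Hilbert-style derivability from assumptions. Modus ponens is the only proper rule, so
  the deduction theorem is an induction in which \<open>K\<close> and \<open>S\<close> do the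
  work.\<close>

inductive derives :: "'a fm set \<Rightarrow> 'a fm \<Rightarrow> bool" for \<Gamma> where
  assm: "A \<in> \<Gamma> \<Longrightarrow> derives \<Gamma> A"
| ipc: "\<turnstile> A \<Longrightarrow> derives \<Gamma> A"
| mp: "derives \<Gamma> (A \<^bold>\<rightarrow> B) \<Longrightarrow> derives \<Gamma> A \<Longrightarrow> derives \<Gamma> B"

lemma derives_empty: "derives {} A \<Longrightarrow> \<turnstile> A"
  by (induction rule: derives.induct) (auto intro: ipc.MP)

lemma deduction: "derives (insert A \<Gamma>) B \<Longrightarrow> derives \<Gamma> (A \<^bold>\<rightarrow> B)"
proof (induction rule: derives.induct)
  case (assm B)
  have "\<turnstile> A \<^bold>\<rightarrow> A"
    using ipc.MP ipc.K ipc.S by metis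
  then show ?case
    using assm by (metis derives.intros ipc.K insertE)
next
  case (ipc B)
  then show ?case by (meson derives.ipc ipc.K ipc.MP)
next
  case (mp B C)
  then show ?case by (meson derives.ipc derives.mp ipc.S)
qed

lemma derives_cut: "derives (insert A \<Gamma>) B \<Longrightarrow> derives \<Gamma> A \<Longrightarrow> derives \<Gamma> B"
  using deduction derives.mp by blast

lemma derives_And [simp]: "derives \<Gamma> (A \<^bold>\<and> B) \<longleftrightarrow> derives \<Gamma> A \<and> derives \<Gamma> B"
  by (meson derives.ipc derives.mp ipc.AndI ipc.AndE1 ipc.AndE2)

lemma derives_OrI: "derives \<Gamma> A \<or> derives \<Gamma> B \<Longrightarrow> derives \<Gamma> (A \<^bold>\<or> B)"
  by (meson derives.ipc derives.mp ipc.OrI1 ipc.OrI2)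

lemma derives_OrE:
  "derives \<Gamma> (A \<^bold>\<or> B) \<Longrightarrow> derives (insert A \<Gamma>) C \<Longrightarrow> derives (insert B \<Gamma>) C \<Longrightarrow> derives \<Gamma> C"
  by (meson deduction derives.ipc derives.mp ipc.OrE)

section \<open>Saturated sets and the canonical tree model\<close>

primrec subformulas :: "'a fm \<Rightarrow> 'a fm set" where
  "subformulas (Atom p) = {Atom p}"
| "subformulas \<^bold>\<bottom> = {\<^bold>\<bottom>}"
| "subformulas (A \<^bold>\<and> B) = insert (A \<^bold>\<and> B) (subformulas A \<union> subformulas B)"
| "subformulas (A \<^bold>\<or> B) = insert (A \<^bold>\<or> B) (subformulas A \<union> subformulas B)"
| "subformulas (A \<^bold>\<rightarrow> B) = insert (A \<^bold>\<rightarrow> B) (subformulas A \<union> subformulas B)"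

lemma finite_subformulas: "finite (subformulas A)"
  by (induction A) auto

lemma subformulas_refl: "A \<in> subformulas A"
  by (cases A) auto

lemma subformulas_trans: "A \<in> subformulas B \<Longrightarrow> subformulas A \<subseteq> subformulas B"
  by (induction B) auto

text \<open>Consistent prime theories relativised to \<Sigma>. With \<Sigma> finite there are only
  finitely many of them, which keeps the models finite.\<close>

definition saturated :: "'a fm set \<Rightarrow> 'a fm set \<Rightarrow> bool" where
  "saturated \<Sigma> \<Gamma> \<longleftrightarrow> \<Gamma> \<subseteq> \<Sigma> \<and> \<not> derives \<Gamma> \<^bold>\<bottom> \<and> (\<forall>A \<in> \<Sigma>. derives \<Gamma> A \<longrightarrow> A \<in> \<Gamma>) \<and>
     (\<forall>A \<in> \<Sigma>. \<forall>B \<in> \<Sigma>. derives \<Gamma> (A \<^bold>\<or> B) \<longrightarrow> A \<in> \<Gamma> \<or> B \<in> \<Gamma>)"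

text \<open>Since \<Sigma> is finite, a maximal subset of \<Sigma> that contains \<Gamma> and does
  not derive \<open>C\<close> exists without Zorn's lemma. By maximality every further formula of
  \<Sigma> makes \<open>C\<close> derivable, which gives closure and primeness.\<close>

lemma saturated_extension:
  assumes fin: "finite \<Sigma>" and sub: "\<Gamma> \<subseteq> \<Sigma>" and not: "\<not> derives \<Gamma> C"
  shows "\<exists>\<Delta>. saturated \<Sigma> \<Delta> \<and> \<Gamma> \<subseteq> \<Delta> \<and> \<not> derives \<Delta> C"
proof -
  define E where "E = {\<Delta>. \<Gamma> \<subseteq> \<Delta> \<and> \<Delta> \<subseteq> \<Sigma> \<and> \<not> derives \<Delta> C}"
  have "finite E"
    unfolding E_def using fin by (auto intro: finite_subset[of _ "Pow \<Sigma>"])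
  moreover have "E \<noteq> {}" unfolding E_def using sub not by blast
  ultimately obtain \<Delta> where "\<Delta> \<in> E" and max: "\<And>\<Delta>'. \<Delta>' \<in> E \<Longrightarrow> \<Delta> \<subseteq> \<Delta>' \<Longrightarrow> \<Delta> = \<Delta>'"
    by (meson finite_has_maximal)
  then have \<Delta>: "\<Gamma> \<subseteq> \<Delta>" "\<Delta> \<subseteq> \<Sigma>" "\<not> derives \<Delta> C"
    unfolding E_def by auto
  have ins: "derives (insert A \<Delta>) C" if "A \<in> \<Sigma>" "A \<notin> \<Delta>" for A
    using max[of "insert A \<Delta>"] \<Delta> that unfolding E_def by blast
  have "\<not> derives \<Delta> \<^bold>\<bottom>"
    using \<Delta> by (meson derives.ipc derives.mp ipc.BotE)
  moreover have "A \<in> \<Delta>" if "A \<in> \<Sigma>" "derives \<Delta> A" for A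
    using ins derives_cut \<Delta> that by blast
  moreover have "A \<in> \<Delta> \<or> B \<in> \<Delta>" if "A \<in> \<Sigma>" "B \<in> \<Sigma>" "derives \<Delta> (A \<^bold>\<or> B)" for A B
    using ins derives_OrE \<Delta> that by blast
  ultimately show ?thesis
    using \<Delta> unfolding saturated_def by blast
qed

text \<open>The tree is built by recursion on the number of formulas of \<Sigma> outside \<Gamma>:
  models of strictly larger saturated sets, one for each implication to be refuted above the root,
  are glued above a root that carries the atoms of \<Gamma>.\<close>

lemma saturated_model:
  assumes fin: "finite \<Sigma>" and closed: "\<And>A. A \<in> \<Sigma> \<Longrightarrow> subformulas A \<subseteq> \<Sigma>"
    and sat: "saturated \<Sigma> \<Gamma>"
  shows "\<exists>K. kripke_model K \<and> (\<forall>A \<in> \<Sigma>. forces K (root K) A \<longleftrightarrow> A \<in> \<Gamma>)"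
  using sat
proof (induction "card (\<Sigma> - \<Gamma>)" arbitrary: \<Gamma> rule: less_induct)
  case less
  note sat = less.prems
  have \<Gamma>: "\<Gamma> \<subseteq> \<Sigma>" "\<And>A. A \<in> \<Sigma> \<Longrightarrow> derives \<Gamma> A \<longleftrightarrow> A \<in> \<Gamma>"
    using sat unfolding saturated_def by (auto intro: derives.assm)
  \<comment> \<open>A missing implication with antecedent in \<Gamma> is refuted at the root itself.
    The others need a world above, and there the new antecedent makes the saturated set strictly
    larger, so the recursion ends.\<close>
  define I where "I = {(B, C). B \<^bold>\<rightarrow> C \<in> \<Sigma> \<and> B \<^bold>\<rightarrow> C \<notin> \<Gamma> \<and> B \<notin> \<Gamma>}"
  have parts: "B \<in> \<Sigma>" "C \<in> \<Sigma>" if "B \<^bold>\<rightarrow> C \<in> \<Sigma>" for B C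
    using closed[OF that] subformulas_refl by auto
  have "I \<subseteq> \<Sigma> \<times> \<Sigma>" unfolding I_def using parts by blast
  then have "finite I" using fin by (meson finite_SigmaI finite_subset)
  then obtain L where L: "set L = I" using finite_list by blast
  have "\<exists>K. kripke_model K \<and> (\<forall>A \<in> \<Gamma>. forces K (root K) A) \<and>
      forces K (root K) (fst x) \<and> \<not> forces K (root K) (snd x)" if x: "x \<in> I" for x
  proof -
    obtain B C where BC: "x = (B, C)" by (cases x)
    have i: "B \<^bold>\<rightarrow> C \<in> \<Sigma>" "B \<^bold>\<rightarrow> C \<notin> \<Gamma>" "B \<notin> \<Gamma>" using x BC unfolding I_def by auto
    have "\<not> derives (insert B \<Gamma>) C" using deduction i \<Gamma> by blast
    then obtain \<Delta> where \<Delta>: "saturated \<Sigma> \<Delta>" "insert B \<Gamma> \<subseteq> \<Delta>" "\<not> derives \<Delta> C"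
      using saturated_extension[OF fin, of "insert B \<Gamma>" C] parts[OF i(1)] \<Gamma>(1) by auto
    have "\<Sigma> - \<Delta> \<subset> \<Sigma> - \<Gamma>" using \<Delta>(2) i(3) parts(1)[OF i(1)] by auto
    then have "card (\<Sigma> - \<Delta>) < card (\<Sigma> - \<Gamma>)" using fin by (intro psubset_card_mono) auto
    from less.hyps[OF this \<Delta>(1)] obtain K
      where K: "kripke_model K" "\<forall>A \<in> \<Sigma>. forces K (root K) A \<longleftrightarrow> A \<in> \<Delta>" by blast
    have "C \<notin> \<Delta>" using \<Delta>(3) derives.assm by blast
    then show ?thesis using K \<Delta>(2) parts[OF i(1)] \<Gamma>(1) BC by (intro exI[of _ K]) auto
  qed
  then obtain M where M: "\<And>x. x \<in> I \<Longrightarrow> kripke_model (M x)"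
    "\<And>x A. x \<in> I \<Longrightarrow> A \<in> \<Gamma> \<Longrightarrow> forces (M x) (root (M x)) A"
    "\<And>x. x \<in> I \<Longrightarrow> forces (M x) (root (M x)) (fst x)"
    "\<And>x. x \<in> I \<Longrightarrow> \<not> forces (M x) (root (M x)) (snd x)"
    by metis
  define v where "v = {p. Atom p \<in> \<Gamma>}"
  let ?G = "glue v (map M L)"
  have G: "kripke_model ?G"
  proof (rule kripke_model_glue)
    fix K assume "K \<in> set (map M L)"
    then obtain x where x: "x \<in> I" "K = M x" using L by auto
    show "kripke_model K \<and> v \<subseteq> val K (root K)"
      using M(1,2)[OF x(1)] x(2) unfolding v_def
      by (metis (mono_tags, lifting) CollectD forces.simps(1) subsetI)
  qed
  have M': "L ! i \<in> I" "map M L ! i = M (L ! i)" if "i < length (map M L)" for i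
    using L that by (auto simp flip: L)
  \<comment> \<open>The truth lemma at the new root; the copies enter only through
    implications.\<close>
  have "forces ?G 0 A \<longleftrightarrow> A \<in> \<Gamma>" if "A \<in> \<Sigma>" for A
    using that
  proof (induction A)
    case (Atom p)
    then show ?case by (simp add: v_def)
  next
    case Bot
    then show ?case using sat derives.assm unfolding saturated_def by auto
  next
    case (And A B)
    then have "A \<in> \<Sigma>" "B \<in> \<Sigma>" using closed[OF And.prems] subformulas_refl by auto
    then show ?case using And \<Gamma> by (metis derives_And forces.simps(3))
  next
    case (Or A B)
    then have "A \<in> \<Sigma>" "B \<in> \<Sigma>" using closed[OF Or.prems] subformulas_refl by auto
    then have "A \<^bold>\<or> B \<in> \<Gamma> \<longleftrightarrow> A \<in> \<Gamma> \<or> B \<in> \<Gamma>"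
      using sat \<Gamma> Or.prems derives_OrI unfolding saturated_def by metis
    then show ?case using Or \<open>A \<in> \<Sigma>\<close> \<open>B \<in> \<Sigma>\<close> by simp
  next
    case (Imp A B)
    note AB = parts[OF Imp.prems]
    show ?case
    proof
      assume f: "forces ?G 0 (A \<^bold>\<rightarrow> B)"
      show "A \<^bold>\<rightarrow> B \<in> \<Gamma>"
      proof (rule ccontr)
        assume not: "A \<^bold>\<rightarrow> B \<notin> \<Gamma>"
        show False
        proof (cases "A \<in> \<Gamma>")
          case True
          moreover have "B \<notin> \<Gamma>"
            using not \<Gamma> AB Imp.prems by (meson derives.ipc derives.mp ipc.K)
          ultimately show False
            using forces_ImpD[OF _ f] Imp.IH AB True by (simp add: worlds_glue)
        next
          case False
          then have "(A, B) \<in> I" using not Imp.prems unfolding I_def by auto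
          then obtain i where i: "i < length (map M L)" "L ! i = (A, B)"
            using L by (metis in_set_conv_nth length_map)
          let ?r = "root (map M L ! i)"
          have r: "?r \<in> worlds (map M L ! i)" using root_in_worlds[OF M(1)[OF M'(1)[OF i(1)]]] M'(2)[OF i(1)] by simp
          have "forces ?G (node i ?r) A" "\<not> forces ?G (node i ?r) B"
            using forces_glue[OF i(1)] M'(2)[OF i(1)] M(3,4)[OF M'(1)[OF i(1)]] i(2)
            by auto
          moreover have "node i ?r \<in> worlds ?G" "(0, node i ?r) \<in> prec ?G"
            using i r by (auto simp: worlds_glue prec_glue)
          ultimately show False using f unfolding forces.simps by blast
        qed
      qed
    next
      assume i: "A \<^bold>\<rightarrow> B \<in> \<Gamma>"
      have "forces ?G x B" if x: "x \<in> worlds ?G" "forces ?G x A" for x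
        using x(1) unfolding worlds_glue
      proof (elim disjE exE conjE)
        assume "x = 0"
        then show ?thesis
          using x(2) i Imp.IH AB \<Gamma> by (metis derives.assm derives.mp)
      next
        fix k w
        assume k: "x = node k w" "k < length (map M L)" "w \<in> worlds (map M L ! k)"
        note Mk = M'(1)[OF k(2)] M'(2)[OF k(2)]
        \<comment> \<open>The root of each copy forces all of \<Gamma>, and persistence carries this
          to \<open>w\<close>.\<close>
        have "forces (map M L ! k) w (A \<^bold>\<rightarrow> B)"
          using forces_root_mono[OF M(1)[OF Mk(1)]] M(2)[OF Mk(1) i] k(3) Mk(2) by metis
        then show ?thesis
          using x(2) forces_glue[OF k(2)] k forces_ImpD by metis
      qed
      then show "forces ?G 0 (A \<^bold>\<rightarrow> B)" by simp
    qed
  qed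
  then show ?case
    using G root_eqI[OF G is_root_glue] by metis
qed

lemma countermodel:
  assumes "\<not> (\<turnstile> A \<^bold>\<rightarrow> B)"
  shows "\<exists>K. kripke_model K \<and> forces K (root K) A \<and> \<not> forces K (root K) B"
proof -
  let ?\<Sigma> = "subformulas (A \<^bold>\<rightarrow> B)"
  have AB: "A \<in> ?\<Sigma>" "B \<in> ?\<Sigma>" using subformulas_refl by auto
  have "\<not> derives {A} B" using assms deduction derives_empty by blast
  then obtain \<Delta> where \<Delta>: "saturated ?\<Sigma> \<Delta>" "{A} \<subseteq> \<Delta>" "\<not> derives \<Delta> B"
    using saturated_extension[OF finite_subformulas, of "{A}" "A \<^bold>\<rightarrow> B" B] AB by auto
  have "B \<notin> \<Delta>" using \<Delta>(3) derives.assm by blast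
  then show ?thesis
    using saturated_model[OF finite_subformulas subformulas_trans \<Delta>(1)] \<Delta>(2) AB by blast
qed

text \<open>Soundness and completeness in one equivalence; from here on derivability is handled by
  forcing alone.\<close>

lemma ipc_imp_iff:
  "(\<turnstile> A \<^bold>\<rightarrow> B) \<longleftrightarrow>
     (\<forall>K w. kripke_model K \<longrightarrow> w \<in> worlds K \<longrightarrow> forces K w A \<longrightarrow> forces K w B)"
  using soundness[of "A \<^bold>\<rightarrow> B"] countermodel[of A B] root_in_worlds by (metis forces.simps(5))

lemma ipc_equiv_iff:
  "ipc_equiv A B \<longleftrightarrow>
     (\<forall>K w. kripke_model K \<longrightarrow> w \<in> worlds K \<longrightarrow> forces K w A = forces K w B)"
  unfolding ipc_equiv_def ipc_imp_iff by blast


section \<open>Components, extendible and prime formulas\<close>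

text \<open>The root is never above another world, so changing its valuation cannot be noticed
  elsewhere.\<close>

lemma forces_variant:
  assumes "variant K' K" "kripke_model K" "w \<in> worlds K" "w \<noteq> root K"
  shows "forces K' w A \<longleftrightarrow> forces K w A"
  using assms(3,4)
proof (induction A arbitrary: w)
  case (Atom p)
  then show ?case using assms(1) unfolding variant_def by auto
next
  case (Imp A B)
  have "v \<noteq> root K" if "(w, v) \<in> prec K" for v
    using that Imp.prems root_prec kripke_model_trans kripke_model_irrefl assms(2) by metis
  then show ?case using Imp assms(1) unfolding variant_def by auto
qed auto

lemma component_imp_extendible:
  assumes "ipc_component B" "ipc_equiv A B"
  shows "extendible A"
  unfolding extendible_def
proof (intro allI impI, elim conjE)
  fix K K' :: "'a kripke"
  assume K: "kripke_model K" "model_forces K A" and K': "kripke_model K'" "model_forces_minus K' A"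
  obtain \<Gamma> \<Delta> where B: "B = Conj \<Gamma> \<^bold>\<and> Conj \<Delta>" and \<Gamma>: "\<forall>C \<in> set \<Gamma>. atomic C"
    and \<Delta>: "\<forall>E \<in> set \<Delta>. \<exists>C D. E = C \<^bold>\<rightarrow> D \<and> atomic C \<and> \<not> (\<turnstile> Conj \<Gamma> \<^bold>\<rightarrow> C)"
    using assms(1) unfolding ipc_component_def by blast
  have eq: "forces M w A \<longleftrightarrow> forces M w B" if "kripke_model M" "w \<in> worlds M" for M w
    using assms(2) that unfolding ipc_equiv_iff by blast
  \<comment> \<open>\<Gamma> is satisfiable, because the root of \<open>K\<close> forces it. Hence
    its members are genuine atoms, and the valuation \<open>v\<close> makes all of them
    true.\<close>
  have bot: "\<^bold>\<bottom> \<notin> set \<Gamma>"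
    using K eq[OF K(1) root_in_worlds[OF K(1)]] B unfolding model_forces_def by auto
  define v where "v = {p. Atom p \<in> set \<Gamma>}"
  let ?V = "K'\<lparr>val := (val K')(root K' := v)\<rparr>"
  have nonroot: "forces K' w B" if "w \<in> worlds K'" "w \<noteq> root K'" for w
    using K'(2) eq[OF K'(1)] that unfolding model_forces_minus_def by auto
  have "v \<subseteq> val K' w" if "w \<in> worlds K'" "w \<noteq> root K'" for w
    using nonroot[OF that] B unfolding v_def by auto
  then have "kripke_model ?V"
    using K'(1) kripke_model_worlds[OF K'(1)] root_prec[OF K'(1)]
      kripke_model_trans[OF K'(1)] kripke_model_irrefl[OF K'(1)]
    unfolding kripke_model_def is_root_def by simp metis
  then have var: "variant ?V K'"
    unfolding variant_def by auto
  have root: "root ?V = root K'" by (rule root_cong) auto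
  have "forces ?V (root K') C" if "C \<in> set \<Gamma>" for C
    using \<Gamma> bot that by - (cases C; auto simp: v_def)
  moreover have "forces ?V (root K') E" if E: "E \<in> set \<Delta>" for E
  proof -
    obtain C D where CD: "E = C \<^bold>\<rightarrow> D" "atomic C" "\<not> (\<turnstile> Conj \<Gamma> \<^bold>\<rightarrow> C)"
      using \<Delta> E by blast
    \<comment> \<open>Underivability from \<Gamma> keeps \<open>C\<close> out of \<Gamma>, so
      \<open>C\<close> fails at the root under \<open>v\<close>. Only the other worlds can then
      trigger the implication, and there it is inherited from \<open>K'\<close>.\<close>
    have "C \<notin> set \<Gamma>" using CD(3) unfolding ipc_imp_iff by auto
    then have C: "\<not> forces ?V (root K') C"
      using CD(2) by (cases C) (auto simp: v_def)
    have "forces K' w (C \<^bold>\<rightarrow> D)" if "w \<in> worlds K'" "w \<noteq> root K'" for w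
      using nonroot[OF that] B E CD by auto
    then have "forces ?V w D" if "w \<in> worlds K'" "w \<noteq> root K'" "forces ?V w C" for w
      using that forces_variant[OF var K'(1)] by (metis forces.simps(5))
    then show ?thesis using C CD(1) by auto
  qed
  ultimately have "forces ?V (root K') B" using B by auto
  then have "model_forces ?V A"
    using eq[OF \<open>kripke_model ?V\<close>] root_in_worlds[OF K'(1)] root
    unfolding model_forces_def by simp
  then show "\<exists>K''. variant K'' K' \<and> model_forces K'' A" using var by blast
qed

section \<open>From extendibility to primeness\<close>

lemma ex_maximal_world:
  assumes "kripke_model K"
  shows "\<exists>m \<in> worlds K. \<forall>w. (m, w) \<notin> prec K"
proof -
  have "finite (prec K)"
    using assms unfolding kripke_model_def by (meson finite_SigmaI finite_subset)
  moreover have "acyclic (prec K)"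
    using assms kripke_model_irrefl unfolding kripke_model_def acyclic_def by (metis trancl_id)
  ultimately have "wf ((prec K)\<inverse>)" by (rule finite_acyclic_wf_converse)
  then show ?thesis
    using root_in_worlds[OF assms] kripke_model_worlds(2)[OF assms] unfolding wf_eq_minimal
    by (metis converse_iff)
qed

text \<open>A maximal world sees only itself, and under a constant valuation all worlds force the
  same formulas. Both sides therefore evaluate \<open>A\<close> classically, whatever the frame of
  \<open>L\<close>.\<close>

lemma forces_maximal_world:
  assumes "m \<in> worlds K" "\<forall>w. (m, w) \<notin> prec K"
  shows "w \<in> worlds L \<Longrightarrow> forces (L\<lparr>val := \<lambda>_. val K m\<rparr>) w A \<longleftrightarrow> forces K m A"
  using assms by (induction A arbitrary: w) auto

text \<open>
  Extendibility lets two countermodels be glued, because the glued frame does carry a model of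
  \<open>A\<close>: the constant valuation taken from a maximal world, where forcing is classical truth.
\<close>

lemma extendible_imp_prime:
  assumes "extendible A"
  shows "ipc_prime A"
  unfolding ipc_prime_def
proof (intro allI impI, rule ccontr)
  fix B C assume or: "\<turnstile> A \<^bold>\<rightarrow> B \<^bold>\<or> C" and "\<not> ((\<turnstile> A \<^bold>\<rightarrow> B) \<or> (\<turnstile> A \<^bold>\<rightarrow> C))"
  then obtain K1 K2 where K1: "kripke_model K1" "forces K1 (root K1) A" "\<not> forces K1 (root K1) B"
    and K2: "kripke_model K2" "forces K2 (root K2) A" "\<not> forces K2 (root K2) C"
    using countermodel by metis
  let ?Ks = "[K1, K2]"
  \<comment> \<open>The empty valuation at \<open>0\<close> is a placeholder: it is trivially
    persistent, and the variant is free to change it.\<close>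
  let ?G = "glue {} ?Ks"
  have model: "kripke_model (?Ks ! i)" if "i < length ?Ks" for i
    using that K1(1) K2(1) by (auto simp: less_Suc_eq)
  have G: "kripke_model ?G" using K1(1) K2(1) by (intro kripke_model_glue) auto
  have root: "root ?G = 0" using root_eqI[OF G is_root_glue] .
  have A: "forces (?Ks ! i) w A" if "i < length ?Ks" "w \<in> worlds (?Ks ! i)" for i w
    using forces_root_mono[OF model[OF that(1)] that(2)] that(1) K1(2) K2(2)
    by (auto simp: less_Suc_eq)
  have "forces ?G x A" if "x \<in> worlds ?G" "x \<noteq> 0" for x
    using that forces_glue A unfolding worlds_glue by metis
  then have minus: "model_forces_minus ?G A"
    unfolding model_forces_minus_def root by blast
  obtain m where m: "m \<in> worlds K1" "\<forall>w. (m, w) \<notin> prec K1"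
    using ex_maximal_world[OF K1(1)] by blast
  let ?L = "?G\<lparr>val := \<lambda>_. val K1 m\<rparr>"
  have L: "kripke_model ?L"
    using G unfolding kripke_model_def is_root_def by simp
  have "root ?L \<in> worlds ?G" using root_in_worlds[OF L] by simp
  then have "model_forces ?L A"
    using forces_maximal_world[OF m] forces_root_mono[OF K1(1) m(1) K1(2)]
    unfolding model_forces_def by blast
  \<comment> \<open>Both models have the same frame, and subframe-models may differ arbitrarily in
    valuation.\<close>
  moreover have "subframe_model ?G ?L"
    using G unfolding subframe_model_def kripke_model_def by auto
  ultimately obtain K where var: "variant K ?G" and K: "model_forces K A"
    using assms L G minus unfolding extendible_def by blast
  have Km: "kripke_model K" using var unfolding variant_def by blast
  have rK: "root K = 0" using var root root_cong unfolding variant_def by metis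
  have "forces K 0 (B \<^bold>\<or> C)"
    using or K Km rK root_in_worlds[OF Km] unfolding ipc_imp_iff model_forces_def by metis
  \<comment> \<open>Anything forced at \<open>0\<close> in the variant persists to the roots of the
    copies, where the variant agrees with \<open>?G\<close>.\<close>
  moreover have not: "\<not> forces K 0 F"
    if i: "i < length ?Ks" and F: "\<not> forces (?Ks ! i) (root (?Ks ! i)) F" for i F
  proof
    assume K0: "forces K 0 F"
    let ?x = "node i (root (?Ks ! i))"
    have r: "root (?Ks ! i) \<in> worlds (?Ks ! i)" using root_in_worlds[OF model[OF i]] .
    then have x: "?x \<in> worlds ?G" using i by (auto simp: worlds_glue)
    then have "?x \<in> worlds K" using var unfolding variant_def by simp
    then have "forces K ?x F" using forces_root_mono[OF Km] K0 rK by simp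
    then have "forces ?G ?x F" using forces_variant[OF var G x] root by simp
    then show False using F forces_glue[OF i] by blast
  qed
  ultimately show False using K1(3) K2(3) not[of 0 B] not[of 1 C] by simp
qed

section \<open>From primeness to components\<close>

text \<open>
  Chosen so that every rewriting step in the proof of \<open>prime_imp_component\<close> lowers the total
  weight, in particular splitting \<open>B \<^bold>\<or> C \<^bold>\<rightarrow> D\<close>, which duplicates \<open>D\<close>, and currying
  \<open>B \<^bold>\<and> C \<^bold>\<rightarrow> D\<close>.
\<close>

primrec weight :: "'a fm \<Rightarrow> nat" where
  "weight (Atom p) = 1"
| "weight \<^bold>\<bottom> = 1"
| "weight (A \<^bold>\<and> B) = weight A * weight B + weight A + weight B + 1"
| "weight (A \<^bold>\<or> B) = weight A + weight B + 1"
| "weight (A \<^bold>\<rightarrow> B) = weight A * (weight B + 1)"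

lemma weight_pos: "0 < weight A"
  by (induction A) auto

text \<open>Two introduction rules can produce an implication, since \<open>Top\<close> abbreviates
  one; in that case both sides are falsum, which is positive and in \<open>NNIL\<close>.\<close>

lemma NNIL_ImpD: "B \<^bold>\<rightarrow> C \<in> NNIL \<Longrightarrow> B \<in> positive \<and> C \<in> NNIL"
  by (erule NNIL.cases) (auto intro: positive.intros NNIL.intros)

lemma NNIL_AndD: "B \<^bold>\<and> C \<in> NNIL \<Longrightarrow> B \<in> NNIL \<and> C \<in> NNIL"
  by (erule NNIL.cases) auto

lemma NNIL_OrD: "B \<^bold>\<or> C \<in> NNIL \<Longrightarrow> B \<in> NNIL \<and> C \<in> NNIL"
  by (erule NNIL.cases) auto

lemma Conj_NNIL: "set As \<subseteq> NNIL \<Longrightarrow> Conj As \<in> NNIL"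
  by (induction As) (auto simp: Conj_def intro: NNIL.intros)

lemma atomic_NNIL: "atomic A \<Longrightarrow> A \<in> NNIL"
  by (cases A) (auto intro: NNIL.intros)

text \<open>Only \<Theta> is weighed, so moving an atom to \<Gamma> lowers the measure; \<Gamma> has
  to vary in the induction.\<close>

lemma prime_imp_component:
  assumes prime: "ipc_prime A"
    and "\<forall>C \<in> set \<Gamma>. atomic C" "set \<Theta> \<subseteq> NNIL" "ipc_equiv A (Conj \<Gamma> \<^bold>\<and> Conj \<Theta>)"
  shows "\<exists>B. ipc_component B \<and> ipc_equiv A B"
  using assms(2-)
proof (induction "sum_list (map weight \<Theta>)" arbitrary: \<Gamma> \<Theta> rule: less_induct)
  case less
  note \<Gamma> = less.prems(1) and \<Theta> = less.prems(2) and eq = less.prems(3)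
  let ?unfired = "\<lambda>E. \<exists>C D. E = C \<^bold>\<rightarrow> D \<and> atomic C \<and> \<not> (\<turnstile> Conj \<Gamma> \<^bold>\<rightarrow> C)"
  show ?case
  proof (cases "\<forall>E \<in> set \<Theta>. ?unfired E")
    case True
    have "Conj \<Gamma> \<^bold>\<and> Conj \<Theta> \<in> NNIL"
      using \<Gamma> \<Theta> by (intro NNIL.intros Conj_NNIL) (auto intro: atomic_NNIL)
    then have "ipc_component (Conj \<Gamma> \<^bold>\<and> Conj \<Theta>)"
      unfolding ipc_component_def using \<Gamma> True by blast
    then show ?thesis using eq by blast
  next
    case False
    then obtain E where E: "E \<in> set \<Theta>" "\<not> ?unfired E" by blast
    \<comment> \<open>Removing a single occurrence makes the weights add up exactly; further copies
      of \<open>E\<close> may remain in \<open>R\<close>.\<close>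
    define R where "R = remove1 E \<Theta>"
    have sum: "sum_list (map weight \<Theta>) = weight E + sum_list (map weight R)"
      using E(1) unfolding R_def by (rule sum_list_map_remove1)
    have R: "set \<Theta> = insert E (set R)"
      using E(1) set_remove1_subset[of E \<Theta>] in_set_remove1[of _ E \<Theta>] unfolding R_def by blast
    have A: "forces K w A \<longleftrightarrow>
        (\<forall>F \<in> set \<Gamma>. forces K w F) \<and> forces K w E \<and> (\<forall>F \<in> set R. forces K w F)"
      if "kripke_model K" "w \<in> worlds K" for K w
      using eq that R unfolding ipc_equiv_iff by auto
    \<comment> \<open>The induction hypothesis in the form of a rewriting rule: \<open>E\<close>
      gives way to the lighter list \<open>Es\<close>, and \<Gamma> to \<open>G\<close>, as long as
      the whole stays equivalent to \<open>A\<close>.\<close>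
    have step: ?thesis
      if "\<forall>F \<in> set G. atomic F" "set Es \<subseteq> NNIL" "sum_list (map weight Es) < weight E"
        and "\<And>K w. kripke_model K \<Longrightarrow> w \<in> worlds K \<Longrightarrow> forces K w A \<longleftrightarrow>
          (\<forall>F \<in> set G. forces K w F) \<and> (\<forall>F \<in> set Es. forces K w F) \<and> (\<forall>F \<in> set R. forces K w F)"
      for G Es
    proof (rule less.hyps[of "Es @ R" G])
      show "sum_list (map weight (Es @ R)) < sum_list (map weight \<Theta>)" using that(3) sum by simp
      show "ipc_equiv A (Conj G \<^bold>\<and> Conj (Es @ R))" unfolding ipc_equiv_iff using that(4) by auto
      show "set (Es @ R) \<subseteq> NNIL" using that(2) \<Theta> R by auto
    qed (use that in auto)
    have EN: "E \<in> NNIL" using E(1) \<Theta> by blast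
    show ?thesis
    proof (cases E)
      case (Atom p)
      then show ?thesis using \<Gamma> A by (intro step[of "E # \<Gamma>" "[]"]) auto
    next
      case Bot
      then show ?thesis using \<Gamma> A by (intro step[of "E # \<Gamma>" "[]"]) auto
    next
      case (And B C)
      then show ?thesis using \<Gamma> A NNIL_AndD[of B C] EN by (intro step[of \<Gamma> "[B, C]"]) auto
    next
      case (Or B C)
      note N = NNIL_OrD[OF EN[unfolded Or]]
      \<comment> \<open>Primeness makes \<open>A\<close> imply one disjunct. That disjunct implies
        the disjunction in turn, so it may replace \<open>E\<close>.\<close>
      have "\<turnstile> A \<^bold>\<rightarrow> B \<^bold>\<or> C" unfolding ipc_imp_iff using A Or by auto
      then consider "\<turnstile> A \<^bold>\<rightarrow> B" | "\<turnstile> A \<^bold>\<rightarrow> C" using prime unfolding ipc_prime_def by blast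
      then show ?thesis
      proof cases
        case 1
        then show ?thesis using \<Gamma> A N Or unfolding ipc_imp_iff
          by (intro step[of \<Gamma> "[B]"]) auto
      next
        case 2
        then show ?thesis using \<Gamma> A N Or unfolding ipc_imp_iff
          by (intro step[of \<Gamma> "[C]"]) auto
      qed
    next
      case (Imp B C)
      note N = NNIL_ImpD[OF EN[unfolded Imp]]
      have pos: "0 < weight B" "0 < weight C" using weight_pos by auto
      have less: "weight C < weight E"
        using Imp pos by (cases "weight B") auto
      \<comment> \<open>In the presence of \<Gamma> the antecedent holds, so the implication amounts
        to its conclusion.\<close>
      have fired: ?thesis if "\<turnstile> Conj \<Gamma> \<^bold>\<rightarrow> B"
      proof (rule step[of \<Gamma> "[C]"])
        fix K :: "'a kripke" and w assume K: "kripke_model K" "w \<in> worlds K"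
        show "forces K w A \<longleftrightarrow> (\<forall>F \<in> set \<Gamma>. forces K w F) \<and> (\<forall>F \<in> set [C]. forces K w F) \<and>
            (\<forall>F \<in> set R. forces K w F)"
          using A[OF K] K that forces_mono[OF K(1)] unfolding ipc_imp_iff Imp by auto
      qed (use \<Gamma> N less in auto)
      from N have "B \<in> positive" by blast
      then show ?thesis
      proof cases
        case (1 p)
        \<comment> \<open>By the choice of \<open>E\<close>, an atomic antecedent must follow from
          \<Gamma>.\<close>
        then show ?thesis using E(2) Imp fired by auto
      next
        case 2
        then show ?thesis using E(2) Imp fired by auto
      next
        case 3
        then show ?thesis using fired unfolding ipc_imp_iff by simp
      next
        case (4 B1 B2)
        show ?thesis
        \<comment> \<open>With weights b1, b2, c the measure drops from (b1*b2 + b1 + b2 + 1)*(c +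
          1) to b1*(b2*(c + 1) + 1).\<close>
        proof (rule step[of \<Gamma> "[B1 \<^bold>\<rightarrow> B2 \<^bold>\<rightarrow> C]"])
          fix K :: "'a kripke" and w assume K: "kripke_model K" "w \<in> worlds K"
          have "forces K w E \<longleftrightarrow> forces K w (B1 \<^bold>\<rightarrow> B2 \<^bold>\<rightarrow> C)"
            unfolding Imp 4
          proof
            assume "forces K w (B1 \<^bold>\<and> B2 \<^bold>\<rightarrow> C)"
            then show "forces K w (B1 \<^bold>\<rightarrow> B2 \<^bold>\<rightarrow> C)"
              by (intro forces_ImpI[OF K(1)]) (metis forces.simps(3) forces_ImpD)
          next
            assume "forces K w (B1 \<^bold>\<rightarrow> B2 \<^bold>\<rightarrow> C)"
            then show "forces K w (B1 \<^bold>\<and> B2 \<^bold>\<rightarrow> C)"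
              by (intro forces_ImpI[OF K(1)]) (metis forces.simps(3) forces_ImpD)
          qed
          then show "forces K w A \<longleftrightarrow> (\<forall>F \<in> set \<Gamma>. forces K w F) \<and>
              (\<forall>F \<in> set [B1 \<^bold>\<rightarrow> B2 \<^bold>\<rightarrow> C]. forces K w F) \<and> (\<forall>F \<in> set R. forces K w F)"
            using A[OF K] by simp
        qed (use \<Gamma> N 4 Imp in \<open>auto intro: NNIL.intros simp: algebra_simps\<close>)
      next
        case (5 B1 B2)
        show ?thesis
        \<comment> \<open>Here it drops from (b1 + b2 + 1)*(c + 1) to (b1 + b2)*(c + 1): the summand
          1 in the weight of a disjunction pays for the second copy of \<open>C\<close>.\<close>
        proof (rule step[of \<Gamma> "[B1 \<^bold>\<rightarrow> C, B2 \<^bold>\<rightarrow> C]"])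
          fix K :: "'a kripke" and w assume K: "kripke_model K" "w \<in> worlds K"
          show "forces K w A \<longleftrightarrow> (\<forall>F \<in> set \<Gamma>. forces K w F) \<and>
              (\<forall>F \<in> set [B1 \<^bold>\<rightarrow> C, B2 \<^bold>\<rightarrow> C]. forces K w F) \<and> (\<forall>F \<in> set R. forces K w F)"
            using A[OF K] unfolding Imp 5 by auto
        qed (use \<Gamma> N 5 Imp in \<open>auto intro: NNIL.intros simp: algebra_simps\<close>)
      qed
    qed
  qed
qed

theorem theorem3p32:
  fixes A :: "'a::finite fm"
  shows "((\<exists>B. ipc_component B \<and> ipc_equiv A B) \<longrightarrow> extendible A) \<and>
         (extendible A \<longrightarrow> ipc_prime A) \<and>
         ((\<exists>N \<in> NNIL. ipc_equiv A N) \<longrightarrow> ipc_prime A \<longrightarrow>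
            (\<exists>B. ipc_component B \<and> ipc_equiv A B))"
proof (intro conjI impI)
  assume "\<exists>N \<in> NNIL. ipc_equiv A N" and prime: "ipc_prime A"
  then obtain N where N: "N \<in> NNIL" "ipc_equiv A N" by blast
  \<comment> \<open>The rewriting starts with no atoms and \<open>N\<close> as the only
    conjunct.\<close>
  then have "ipc_equiv A (Conj [] \<^bold>\<and> Conj [N])" unfolding ipc_equiv_iff by simp
  then show "\<exists>B. ipc_component B \<and> ipc_equiv A B"
    using prime_imp_component[OF prime, of "[]" "[N]"] N(1) by simp
qed (use component_imp_extendible extendible_imp_prime in blast)+

end
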